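(* Let $(f,\varphi)\colon A\rightleftharpoons B$ and $(g,\gamma)\colon C\rightleftharpoons B$ be lenses. If the underlying functor $f\colon A\to B$ or the underlying functor $g\colon C\to B$ is a discrete opfibration, then the imported pullback $A\times_B C$ of this cospan coincides with the categorical pullback in $\mathcal{L}\mathrm{ens}$; that is, the commutative square in $\mathcal{L}\mathrm{ens}$ formed by the imported pullback projection lenses $\pi_0\colon A\times_B C\rightleftharpoons A$ and $\pi_1\colon A\times_B C\rightleftharpoons C$ together with $(f,\varphi)$ and $(g,\gamma)$ is a pullback square in $\mathcal{L}\mathrm{ens}$.
   Context: All categories that are objects of $\mathcal{L}\mathrm{ens}$ are small. A (delta) lens $(f,\varphi)\colon A \rightleftharpoons B$ between small categories consists of a functor $f\colon A\to B$ together with a lifting operation assigning to each pair ($a\in A$, $u\colon fa\to b$ in $B$) a morphism $\varphi(a,u)\colon a\to a'$ of $A$ with domain $a$, such that (1) $f\varphi(a,u)=u$; (2) $\varphi(a,1_{fa})=1_a$; (3) $\varphi(a,v\circ u)=\varphi(a',v)\circ\varphi(a,u)$, where $a'$ is the codomain of $\varphi(a,u)$. $\mathcal{L}\mathrm{ens}$ is the category with small categories as objects and lenses as morphisms; the composite of $(f,\varphi)\colon A\rightleftharpoons B$ and $(g,\gamma)\colon B\rightleftharpoons C$ is the functor $g\circ f$ with lifting operation $(a,u\colon gfa\to c)\mapsto \varphi(a,\gamma(fa,u))$, and the identity lens on $A$ is the identity functor with lifting operation $(a,u)\mapsto u$. The imported pullback of lenses $(f,\varphi)\colon A\rightleftharpoons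 B$ and $(g,\gamma)\colon C\rightleftharpoons B$ is the pullback category $A\times_B C$ of $f$ and $g$ in $\mathcal{C}\mathrm{at}$ (objects: pairs $(a,c)$ with $fa=gc$; morphisms: pairs $(u,w)$ with $fu=gw$), together with the projection lenses whose underlying functors are the pullback projections $\pi_0,\pi_1$, with lifting operations $((a,c),u\colon a\to a')\mapsto(u,\gamma(c,fu))$ and $((a,c),w\colon c\to c')\mapsto(\varphi(a,gw),w)$ respectively; these satisfy $(f,\varphi)\circ\pi_0=(g,\gamma)\circ\pi_1$ in $\mathcal{L}\mathrm{ens}$. A functor $f\colon A\to B$ is a discrete opfibration if for all pairs ($a\in A$, $u\colon fa\to b$ in $B$) there is a unique morphism $w\colon a\to a'$ in $A$ with domain $a$ and $fw=u$. *)

theory Defs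
  imports "HOL-Library.FuncSet"
begin

section \<open>Small categories\<close>

text \<open>
  Only the values of the operations on the carrier sets \<open>Obj\<close>, \<open>Arr\<close> (and, for \<open>Comp\<close>, on
  composable pairs) are meaningful. \<open>Comp C v u\<close> is \<open>v \<circ> u\<close>, that is, first \<open>u\<close>, then \<open>v\<close>.
\<close>

record ('o, 'm) cat =
  Obj :: "'o set"
  Arr :: "'m set"
  Dom :: "'m \<Rightarrow> 'o"
  Cod :: "'m \<Rightarrow> 'o"
  Id :: "'o \<Rightarrow> 'm"
  Comp :: "'m \<Rightarrow> 'm \<Rightarrow> 'm"

definition category :: "('o, 'm) cat \<Rightarrow> bool" where
  "category C \<longleftrightarrow>
     (\<forall>u\<in>Arr C. Dom C u \<in> Obj C \<and> Cod C u \<in> Obj C) \<and>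
     (\<forall>a\<in>Obj C. Id C a \<in> Arr C \<and> Dom C (Id C a) = a \<and> Cod C (Id C a) = a) \<and>
     (\<forall>u\<in>Arr C. \<forall>v\<in>Arr C. Dom C v = Cod C u \<longrightarrow>
        Comp C v u \<in> Arr C \<and> Dom C (Comp C v u) = Dom C u \<and> Cod C (Comp C v u) = Cod C v) \<and>
     (\<forall>u\<in>Arr C. Comp C u (Id C (Dom C u)) = u \<and> Comp C (Id C (Cod C u)) u = u) \<and>
     (\<forall>u\<in>Arr C. \<forall>v\<in>Arr C. \<forall>w\<in>Arr C. Dom C v = Cod C u \<and> Dom C w = Cod C v \<longrightarrow>
        Comp C w (Comp C v u) = Comp C (Comp C w v) u)"


section \<open>Functors and discrete opfibrations\<close>

text \<open>
  The maps making up a functor or a lens are required to be extensional (constantly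
  \<open>undefined\<close> outside their domain), so that HOL equality of the records is equality of
  functors and of lenses, respectively.
\<close>

record ('o, 'm, 'p, 'n) fctr =
  on_obj :: "'o \<Rightarrow> 'p"
  on_arr :: "'m \<Rightarrow> 'n"

definition is_functor ::
  "('o, 'm) cat \<Rightarrow> ('p, 'n) cat \<Rightarrow> ('o, 'm, 'p, 'n, 'z) fctr_scheme \<Rightarrow> bool" where
  "is_functor A B f \<longleftrightarrow>
     on_obj f \<in> Obj A \<rightarrow>\<^sub>E Obj B \<and>
     on_arr f \<in> Arr A \<rightarrow>\<^sub>E Arr B \<and>
     (\<forall>u\<in>Arr A. Dom B (on_arr f u) = on_obj f (Dom A u) \<and>
                Cod B (on_arr f u) = on_obj f (Cod A u)) \<and>
     (\<forall>a\<in>Obj A. on_arr f (Id A a) = Id B (on_obj f a)) \<and>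
     (\<forall>u\<in>Arr A. \<forall>v\<in>Arr A. Dom A v = Cod A u \<longrightarrow>
        on_arr f (Comp A v u) = Comp B (on_arr f v) (on_arr f u))"

definition discrete_opfibration ::
  "('o, 'm) cat \<Rightarrow> ('p, 'n) cat \<Rightarrow> ('o, 'm, 'p, 'n, 'z) fctr_scheme \<Rightarrow> bool" where
  "discrete_opfibration A B f \<longleftrightarrow>
     is_functor A B f \<and>
     (\<forall>a\<in>Obj A. \<forall>u\<in>Arr B. Dom B u = on_obj f a \<longrightarrow>
        (\<exists>!w. w \<in> Arr A \<and> Dom A w = a \<and> on_arr f w = u))"


section \<open>Delta lenses\<close>

record ('o, 'm, 'p, 'n) lens = "('o, 'm, 'p, 'n) fctr" +
  lift :: "'o \<times> 'n \<Rightarrow> 'm"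

definition lift_dom :: "('o, 'm) cat \<Rightarrow> ('p, 'n) cat \<Rightarrow> ('o \<Rightarrow> 'p) \<Rightarrow> ('o \<times> 'n) set" where
  "lift_dom A B f = {(a, u). a \<in> Obj A \<and> u \<in> Arr B \<and> Dom B u = f a}"

definition is_lens ::
  "('o, 'm) cat \<Rightarrow> ('p, 'n) cat \<Rightarrow> ('o, 'm, 'p, 'n) lens \<Rightarrow> bool" where
  "is_lens A B F \<longleftrightarrow>
     is_functor A B F \<and>
     lift F \<in> lift_dom A B (on_obj F) \<rightarrow>\<^sub>E Arr A \<and>
     (\<forall>(a, u) \<in> lift_dom A B (on_obj F).
        Dom A (lift F (a, u)) = a \<and> on_arr F (lift F (a, u)) = u) \<and>
     (\<forall>a\<in>Obj A. lift F (a, Id B (on_obj F a)) = Id A a) \<and>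
     (\<forall>(a, u) \<in> lift_dom A B (on_obj F). \<forall>v\<in>Arr B. Dom B v = Cod B u \<longrightarrow>
        lift F (a, Comp B v u) =
          Comp A (lift F (Cod A (lift F (a, u)), v)) (lift F (a, u)))"

text \<open>
  The composite of \<open>F\<close> from \<open>A\<close> to some category \<open>B\<close> with \<open>G\<close> from \<open>B\<close> to \<open>C\<close>. The outer
  categories are arguments only because the maps have to be restricted to their domains.
\<close>

definition lens_comp ::
  "('o, 'm) cat \<Rightarrow> ('q, 'l) cat \<Rightarrow> ('p, 'n, 'q, 'l) lens \<Rightarrow> ('o, 'm, 'p, 'n) lens
     \<Rightarrow> ('o, 'm, 'q, 'l) lens" where
  "lens_comp A C G F =
     \<lparr> on_obj = restrict (\<lambda>a. on_obj G (on_obj F a)) (Obj A),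
       on_arr = restrict (\<lambda>u. on_arr G (on_arr F u)) (Arr A),
       lift = restrict (\<lambda>(a, u). lift F (a, lift G (on_obj F a, u)))
                (lift_dom A C (\<lambda>a. on_obj G (on_obj F a))) \<rparr>"


section \<open>Imported pullbacks\<close>

definition pullback_cat ::
  "('o, 'm) cat \<Rightarrow> ('q, 'l) cat \<Rightarrow> ('o, 'm, 'p, 'n, 'y) fctr_scheme
     \<Rightarrow> ('q, 'l, 'p, 'n, 'z) fctr_scheme \<Rightarrow> ('o \<times> 'q, 'm \<times> 'l) cat" where
  "pullback_cat A C f g =
     \<lparr> Obj = {(a, c). a \<in> Obj A \<and> c \<in> Obj C \<and> on_obj f a = on_obj g c},
       Arr = {(u, w). u \<in> Arr A \<and> w \<in> Arr C \<and> on_arr f u = on_arr g w},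
       Dom = (\<lambda>(u, w). (Dom A u, Dom C w)),
       Cod = (\<lambda>(u, w). (Cod A u, Cod C w)),
       Id = (\<lambda>(a, c). (Id A a, Id C c)),
       Comp = (\<lambda>(u', w') (u, w). (Comp A u' u, Comp C w' w)) \<rparr>"

definition imported_proj0 ::
  "('o, 'm) cat \<Rightarrow> ('q, 'l) cat \<Rightarrow> ('o, 'm, 'p, 'n) lens \<Rightarrow> ('q, 'l, 'p, 'n) lens
     \<Rightarrow> ('o \<times> 'q, 'm \<times> 'l, 'o, 'm) lens" where
  "imported_proj0 A C F G =
     (let P = pullback_cat A C F G in
      \<lparr> on_obj = restrict fst (Obj P),
        on_arr = restrict fst (Arr P),
        lift = restrict (\<lambda>((a, c), u). (u, lift G (c, on_arr F u))) (lift_dom P A fst) \<rparr>)"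

definition imported_proj1 ::
  "('o, 'm) cat \<Rightarrow> ('q, 'l) cat \<Rightarrow> ('o, 'm, 'p, 'n) lens \<Rightarrow> ('q, 'l, 'p, 'n) lens
     \<Rightarrow> ('o \<times> 'q, 'm \<times> 'l, 'q, 'l) lens" where
  "imported_proj1 A C F G =
     (let P = pullback_cat A C F G in
      \<lparr> on_obj = restrict snd (Obj P),
        on_arr = restrict snd (Arr P),
        lift = restrict (\<lambda>((a, c), w). (lift F (a, on_arr G w), w)) (lift_dom P C snd) \<rparr>)"


section \<open>Pullback squares in the category of small categories and lenses\<close>

text \<open>
  HOL has no quantifier over types inside formulas, so the type of the small categories \<open>X\<close>
  against which the universal property is tested is passed as an argument. Pullback squares
  of lenses are those with \<open>lens_pullback_square T P A C B \<pi>\<^sub>0 \<pi>\<^sub>1 F G\<close> for \<open>T = TYPE(('x, 'y) cat)\<close>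
  with arbitrary \<open>'x\<close> and \<open>'y\<close>; a theorem should leave both as type variables.
\<close>

definition lens_pullback_square ::
  "('x, 'y) cat itself \<Rightarrow> ('r, 'k) cat \<Rightarrow> ('o, 'm) cat \<Rightarrow> ('q, 'l) cat \<Rightarrow> ('p, 'n) cat
     \<Rightarrow> ('r, 'k, 'o, 'm) lens \<Rightarrow> ('r, 'k, 'q, 'l) lens
     \<Rightarrow> ('o, 'm, 'p, 'n) lens \<Rightarrow> ('q, 'l, 'p, 'n) lens \<Rightarrow> bool" where
  "lens_pullback_square T P A C B \<pi>\<^sub>0 \<pi>\<^sub>1 F G \<longleftrightarrow>
     category P \<and> category A \<and> category C \<and> category B \<and>
     is_lens P A \<pi>\<^sub>0 \<and> is_lens P C \<pi>\<^sub>1 \<and> is_lens A B F \<and> is_lens C B G \<and>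
     lens_comp P B F \<pi>\<^sub>0 = lens_comp P B G \<pi>\<^sub>1 \<and>
     (\<forall>(X :: ('x, 'y) cat) H K.
        category X \<and> is_lens X A H \<and> is_lens X C K \<and> lens_comp X B F H = lens_comp X B G K \<longrightarrow>
        (\<exists>!L. is_lens X P L \<and> lens_comp X A \<pi>\<^sub>0 L = H \<and> lens_comp X C \<pi>\<^sub>1 L = K))"

end

theory Submission
  imports Defs
begin

text \<open>
  A lifting operation over a discrete opfibration is determined by the underlying functor.
  Consequently a functor \<open>L\<close> into the domain of a discrete opfibration \<open>Q\<close> carries exactly one
  lens structure making \<open>Q \<circ> L\<close> a prescribed lens, and a discrete opfibration can be cancelled
  from an equation of lenses as soon as the underlying functors agree. If, say, \<open>F\<close> is a
  discrete opfibration, then so is its pullback \<open>\<pi>\<^sub>1\<close>. Hence the pairing functor induced by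
  lenses \<open>H\<close> and \<open>K\<close> has exactly one lens structure \<open>L\<close> with \<open>\<pi>\<^sub>1 \<circ> L = K\<close>, and
  \<open>F \<circ> \<pi>\<^sub>0 \<circ> L = G \<circ> \<pi>\<^sub>1 \<circ> L = G \<circ> K = F \<circ> H\<close> gives \<open>\<pi>\<^sub>0 \<circ> L = H\<close> by cancelling \<open>F\<close>.
\<close>

section \<open>Axioms of categories, functors and lenses as rules\<close>

lemma category_simps:
  assumes "category A"
  shows "u \<in> Arr A \<Longrightarrow> Dom A u \<in> Obj A"
    and "u \<in> Arr A \<Longrightarrow> Cod A u \<in> Obj A"
    and "a \<in> Obj A \<Longrightarrow> Id A a \<in> Arr A"
    and "a \<in> Obj A \<Longrightarrow> Dom A (Id A a) = a"
    and "a \<in> Obj A \<Longrightarrow> Cod A (Id A a) = a"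
    and "\<lbrakk>u \<in> Arr A; v \<in> Arr A; Dom A v = Cod A u\<rbrakk> \<Longrightarrow> Comp A v u \<in> Arr A"
    and "\<lbrakk>u \<in> Arr A; v \<in> Arr A; Dom A v = Cod A u\<rbrakk> \<Longrightarrow> Dom A (Comp A v u) = Dom A u"
    and "\<lbrakk>u \<in> Arr A; v \<in> Arr A; Dom A v = Cod A u\<rbrakk> \<Longrightarrow> Cod A (Comp A v u) = Cod A v"
  using assms by (auto simp: category_def)

lemma category_unit_assoc:
  assumes "category A"
  shows "u \<in> Arr A \<Longrightarrow> Comp A u (Id A (Dom A u)) = u"
    and "u \<in> Arr A \<Longrightarrow> Comp A (Id A (Cod A u)) u = u"
    and "\<lbrakk>u \<in> Arr A; v \<in> Arr A; w \<in> Arr A; Dom A v = Cod A u; Dom A w = Cod A v\<rbrakk>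
      \<Longrightarrow> Comp A w (Comp A v u) = Comp A (Comp A w v) u"
  using assms by (auto simp: category_def)

lemma functor_simps:
  assumes "is_functor A B f"
  shows "a \<in> Obj A \<Longrightarrow> on_obj f a \<in> Obj B"
    and "u \<in> Arr A \<Longrightarrow> on_arr f u \<in> Arr B"
    and "u \<in> Arr A \<Longrightarrow> Dom B (on_arr f u) = on_obj f (Dom A u)"
    and "u \<in> Arr A \<Longrightarrow> Cod B (on_arr f u) = on_obj f (Cod A u)"
    and "a \<in> Obj A \<Longrightarrow> on_arr f (Id A a) = Id B (on_obj f a)"
    and "\<lbrakk>u \<in> Arr A; v \<in> Arr A; Dom A v = Cod A u\<rbrakk>
      \<Longrightarrow> on_arr f (Comp A v u) = Comp B (on_arr f v) (on_arr f u)"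
  using assms by (auto simp: is_functor_def)

lemma functor_extensional:
  assumes "is_functor A B f"
  shows "on_obj f \<in> extensional (Obj A)" and "on_arr f \<in> extensional (Arr A)"
  using assms by (auto simp: is_functor_def PiE_def)

lemma lens_functor: "is_lens A B F \<Longrightarrow> is_functor A B F"
  by (simp add: is_lens_def)

lemma lens_simps:
  assumes "is_lens A B F"
  shows "\<lbrakk>a \<in> Obj A; u \<in> Arr B; Dom B u = on_obj F a\<rbrakk> \<Longrightarrow> lift F (a, u) \<in> Arr A"
    and "\<lbrakk>a \<in> Obj A; u \<in> Arr B; Dom B u = on_obj F a\<rbrakk> \<Longrightarrow> Dom A (lift F (a, u)) = a"
    and "\<lbrakk>a \<in> Obj A; u \<in> Arr B; Dom B u = on_obj F a\<rbrakk> \<Longrightarrow> on_arr F (lift F (a, u)) = u"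
    and "a \<in> Obj A \<Longrightarrow> lift F (a, Id B (on_obj F a)) = Id A a"
    and "\<lbrakk>a \<in> Obj A; u \<in> Arr B; v \<in> Arr B; Dom B u = on_obj F a; Dom B v = Cod B u\<rbrakk>
      \<Longrightarrow> lift F (a, Comp B v u) = Comp A (lift F (Cod A (lift F (a, u)), v)) (lift F (a, u))"
  using assms by (auto simp: is_lens_def lift_dom_def)

lemma lens_lift_extensional:
  "is_lens A B F \<Longrightarrow> lift F \<in> extensional (lift_dom A B (on_obj F))"
  by (simp add: is_lens_def PiE_def)

text \<open>Functors preserve codomains and \<open>on_arr F (lift F (a, u)) = u\<close>. Hence an
  arrow composable with \<open>u\<close> can be lifted at the endpoint of the lift of
  \<open>u\<close>, as the composition law requires.\<close>

lemma lens_Cod_lift: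
  assumes "category A" and "is_lens A B F"
    and "a \<in> Obj A" and "u \<in> Arr B" and "Dom B u = on_obj F a"
  shows "Cod A (lift F (a, u)) \<in> Obj A" and "on_obj F (Cod A (lift F (a, u))) = Cod B u"
  using assms category_simps(2)[of A] lens_simps(1,3)[of A B F]
    functor_simps(4)[OF lens_functor[of A B F]]
  by (metis, metis)

lemma is_lensI:
  assumes "is_functor A B F"
    and "lift F \<in> extensional (lift_dom A B (on_obj F))"
    and "\<And>a u. \<lbrakk>a \<in> Obj A; u \<in> Arr B; Dom B u = on_obj F a\<rbrakk> \<Longrightarrow> lift F (a, u) \<in> Arr A"
    and "\<And>a u. \<lbrakk>a \<in> Obj A; u \<in> Arr B; Dom B u = on_obj F a\<rbrakk> \<Longrightarrow> Dom A (lift F (a, u)) = a"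
    and "\<And>a u. \<lbrakk>a \<in> Obj A; u \<in> Arr B; Dom B u = on_obj F a\<rbrakk> \<Longrightarrow> on_arr F (lift F (a, u)) = u"
    and "\<And>a. a \<in> Obj A \<Longrightarrow> lift F (a, Id B (on_obj F a)) = Id A a"
    and "\<And>a u v. \<lbrakk>a \<in> Obj A; u \<in> Arr B; v \<in> Arr B; Dom B u = on_obj F a; Dom B v = Cod B u\<rbrakk>
      \<Longrightarrow> lift F (a, Comp B v u) = Comp A (lift F (Cod A (lift F (a, u)), v)) (lift F (a, u))"
  shows "is_lens A B F"
  using assms by (auto simp: is_lens_def lift_dom_def PiE_def)

section \<open>Composition and equality of lenses\<close>

lemma lens_comp_simps:
  shows "a \<in> Obj A \<Longrightarrow> on_obj (lens_comp A C G F) a = on_obj G (on_obj F a)"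
    and "u \<in> Arr A \<Longrightarrow> on_arr (lens_comp A C G F) u = on_arr G (on_arr F u)"
    and "\<lbrakk>a \<in> Obj A; w \<in> Arr C; Dom C w = on_obj G (on_obj F a)\<rbrakk>
      \<Longrightarrow> lift (lens_comp A C G F) (a, w) = lift F (a, lift G (on_obj F a, w))"
  by (auto simp: lens_comp_def lift_dom_def)

text \<open>Object maps of composites and projections are restricted, while their lifting operations
  are defined over the unrestricted maps. Only values on \<open>Obj A\<close> enter
  \<open>lift_dom\<close>, so both give the same domain.\<close>

lemma lift_dom_cong:
  "(\<And>a. a \<in> Obj A \<Longrightarrow> f a = g a) \<Longrightarrow> lift_dom A B f = lift_dom A B g"
  by (auto simp: lift_dom_def)

lemma lens_comp_extensional:
  shows "on_obj (lens_comp A C G F) \<in> extensional (Obj A)"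
    and "on_arr (lens_comp A C G F) \<in> extensional (Arr A)"
    and "lift (lens_comp A C G F) \<in> extensional (lift_dom A C (on_obj (lens_comp A C G F)))"
proof -
  have "lift_dom A C (on_obj (lens_comp A C G F)) = lift_dom A C (\<lambda>a. on_obj G (on_obj F a))"
    by (rule lift_dom_cong) (rule lens_comp_simps)
  then show "lift (lens_comp A C G F) \<in> extensional (lift_dom A C (on_obj (lens_comp A C G F)))"
    by (simp add: lens_comp_def)
qed (simp_all add: lens_comp_def)

text \<open>The domain of \<open>lift\<close> depends on the object map, so object maps are compared
  first. Assuming extensionality instead of \<open>is_lens\<close> lets the rule apply directly to
  composites.\<close>

lemma lens_eqI:
  fixes M N :: "('o, 'm, 'p, 'n) lens"
  assumes "on_obj M \<in> extensional (Obj A)" and "on_obj N \<in> extensional (Obj A)"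
    and "on_arr M \<in> extensional (Arr A)" and "on_arr N \<in> extensional (Arr A)"
    and "lift M \<in> extensional (lift_dom A B (on_obj M))"
    and "lift N \<in> extensional (lift_dom A B (on_obj N))"
    and "\<And>a. a \<in> Obj A \<Longrightarrow> on_obj M a = on_obj N a"
    and "\<And>u. u \<in> Arr A \<Longrightarrow> on_arr M u = on_arr N u"
    and "\<And>a u. \<lbrakk>a \<in> Obj A; u \<in> Arr B; Dom B u = on_obj M a\<rbrakk> \<Longrightarrow> lift M (a, u) = lift N (a, u)"
  shows "M = N"
proof -
  have o: "on_obj M = on_obj N" and a: "on_arr M = on_arr N"
    using assms by (auto intro: extensionalityI)
  have "lift M = lift N"
    by (rule extensionalityI[OF assms(5) assms(6)[folded o]]) (auto simp: lift_dom_def assms(9))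
  with o a show ?thesis by simp
qed

lemma lens_comp_is_lens:
  assumes A: "category A" and B: "category B" and C: "category C"
    and F: "is_lens A B F" and G: "is_lens B C G"
  shows "is_lens A C (lens_comp A C G F)"
proof -
  note simps = lens_comp_simps category_simps[OF A] category_simps[OF C]
    functor_simps[OF lens_functor[OF F]] functor_simps[OF lens_functor[OF G]]
    lens_simps[OF F] lens_simps[OF G] lens_Cod_lift[OF A F] lens_Cod_lift[OF B G]
  have "is_functor A C (lens_comp A C G F)"
    unfolding is_functor_def PiE_def by (auto simp: simps lens_comp_extensional)
  then show ?thesis
    by (rule is_lensI[OF _ lens_comp_extensional(3)]) (auto simp: simps)
qed

lemma lens_comp_assoc:
  assumes L: "is_lens X P L" and Q: "is_lens P A Q" and F: "is_lens A B F"
  shows "lens_comp X B (lens_comp P B F Q) L = lens_comp X B F (lens_comp X A Q L)"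
  by (rule lens_eqI[where A = X and B = B])
    (auto simp: lens_comp_extensional lens_comp_simps functor_simps[OF lens_functor[OF L]]
      functor_simps[OF lens_functor[OF Q]] lens_simps[OF F])

section \<open>Lenses over discrete opfibrations\<close>

lemma discrete_opfibration_eqI:
  assumes "discrete_opfibration A B F" and "u \<in> Arr A" and "v \<in> Arr A"
    and "category A" and "Dom A u = Dom A v" and "on_arr F u = on_arr F v"
  shows "u = v"
proof -
  have "is_functor A B F" and ex1: "\<And>a u. \<lbrakk>a \<in> Obj A; u \<in> Arr B; Dom B u = on_obj F a\<rbrakk>
      \<Longrightarrow> \<exists>!w. w \<in> Arr A \<and> Dom A w = a \<and> on_arr F w = u"
    using assms(1) by (auto simp: discrete_opfibration_def)
  with ex1[of "Dom A u" "on_arr F u"] assms show ?thesis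
    by (metis functor_simps(2,3) category_simps(1))
qed

text \<open>Both arrows start at the same object and lie over the same arrow, so uniqueness
  identifies them. Thus each arrow of \<open>P\<close> is the chosen lift of its image.\<close>

lemma lift_discrete_opfibration:
  assumes "category P" and "is_lens P D Q" and "discrete_opfibration P D Q" and "r \<in> Arr P"
  shows "lift Q (Dom P r, on_arr Q r) = r"
  using assms category_simps(1)[OF assms(1,4)] functor_simps[OF lens_functor[OF assms(2)]]
    lens_simps(1-3)[OF assms(2), of "Dom P r" "on_arr Q r"]
  by (intro discrete_opfibration_eqI[OF assms(3)]) auto

text \<open>Only the lifting operations remain to be compared. As \<open>r\<close> is the chosen
  lift of its image under \<open>Q\<close>, lifting \<open>r\<close> along \<open>M\<close> amounts
  to lifting that image along the composite, and the composites agree.\<close>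

lemma lens_cancel_discrete_opfibration:
  assumes P: "category P" and M: "is_lens X P M" and N: "is_lens X P N"
    and Q: "is_lens P D Q" "discrete_opfibration P D Q"
    and eq: "lens_comp X D Q M = lens_comp X D Q N"
    and obj: "on_obj M = on_obj N" and arr: "on_arr M = on_arr N"
  shows "M = N"
proof (rule lens_eqI[where A = X and B = P])
  fix x r assume xr: "x \<in> Obj X" "r \<in> Arr P" "Dom P r = on_obj M x"
  let ?u = "on_arr Q r"
  have u: "?u \<in> Arr D" "Dom D ?u = on_obj Q (on_obj M x)"
    using xr functor_simps[OF lens_functor[OF Q(1)]] by auto
  have r: "lift Q (on_obj M x, ?u) = r"
    using lift_discrete_opfibration[OF P Q xr(2)] xr(3) by simp
  have "lift M (x, r) = lift (lens_comp X D Q M) (x, ?u)"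
    using xr u by (simp add: lens_comp_simps r)
  also have "\<dots> = lift N (x, r)"
    using xr u r by (simp add: eq lens_comp_simps flip: obj)
  finally show "lift M (x, r) = lift N (x, r)" .
qed (simp_all add: obj arr functor_extensional[OF lens_functor[OF N]]
      lens_lift_extensional[OF N] lens_lift_extensional[OF M, unfolded obj])

lemma lens_over_discrete_opfibration:
  fixes L :: "('x, 'y, 'r, 'k) fctr" and M :: "('x, 'y, 'd, 'e) lens"
  assumes X: "category X" and P: "category P" and L: "is_functor X P L"
    and Q: "is_lens P D Q" "discrete_opfibration P D Q" and M: "is_lens X D M"
    and obj: "\<And>x. x \<in> Obj X \<Longrightarrow> on_obj Q (on_obj L x) = on_obj M x"
    and arr: "\<And>y. y \<in> Arr X \<Longrightarrow> on_arr Q (on_arr L y) = on_arr M y"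
  obtains L' :: "('x, 'y, 'r, 'k) lens"
  where "is_lens X P L'" and "on_obj L' = on_obj L" and "on_arr L' = on_arr L"
    and "lens_comp X D Q L' = M"
proof
  \<comment> \<open>The formula is forced: \<open>r\<close> is the lift of \<open>on_arr Q r\<close>
    along \<open>Q\<close>, so a lens structure on \<open>L\<close> with composite \<open>M\<close>
    must lift \<open>r\<close> as \<open>M\<close> lifts \<open>on_arr Q r\<close>.\<close>
  define l where
    "l = restrict (\<lambda>(x, r). lift M (x, on_arr Q r)) (lift_dom X P (on_obj L))"
  have l_ext: "l \<in> extensional (lift_dom X P (on_obj L))"
    by (simp add: l_def)
  define L' where "L' = \<lparr>on_obj = on_obj L, on_arr = on_arr L, lift = l\<rparr>"
  have L'_simps [simp]: "on_obj L' = on_obj L" "on_arr L' = on_arr L" "lift L' = l"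
    by (simp_all add: L'_def)
  show "on_obj L' = on_obj L" "on_arr L' = on_arr L"
    by simp_all
  note Qf = functor_simps[OF lens_functor[OF Q(1)]] and Lf = functor_simps[OF L]
  have l: "l (x, r) = lift M (x, on_arr Q r)"
    if "x \<in> Obj X" "r \<in> Arr P" "Dom P r = on_obj L x" for x r
    using that by (simp add: l_def lift_dom_def)
  have u: "on_arr Q r \<in> Arr D" "Dom D (on_arr Q r) = on_obj M x"
    if "x \<in> Obj X" "r \<in> Arr P" "Dom P r = on_obj L x" for x r
    using that Qf obj by auto
  have lM: "l (x, r) \<in> Arr X" "Dom X (l (x, r)) = x"
    "on_arr M (l (x, r)) = on_arr Q r"
    if "x \<in> Obj X" "r \<in> Arr P" "Dom P r = on_obj L x" for x r
    using that lens_simps(1-3)[OF M that(1) u[OF that]] by (simp_all add: l)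
  \<comment> \<open>Both arrows start at \<open>on_obj L x\<close>, and \<open>Q\<close> sends both
    to \<open>on_arr Q r\<close>.\<close>
  have Ll: "on_arr L (l (x, r)) = r"
    if "x \<in> Obj X" "r \<in> Arr P" "Dom P r = on_obj L x" for x r
    by (rule discrete_opfibration_eqI[OF Q(2)])
      (use that lM[OF that] Lf P arr in auto)
  have Cod_l: "Cod X (l (x, r)) \<in> Obj X" "on_obj L (Cod X (l (x, r))) = Cod P r"
    if "x \<in> Obj X" "r \<in> Arr P" "Dom P r = on_obj L x" for x r
    using that lM(1)[OF that] Ll[OF that] Lf(4) category_simps(2)[OF X] by (metis, metis)
  show "is_lens X P L'"
  proof (rule is_lensI, unfold L'_simps)
    show "is_functor X P L'"
      using L by (simp add: is_functor_def)
    show "l (x, Id P (on_obj L x)) = Id X x" if "x \<in> Obj X" for x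
      using that by (simp add: l category_simps[OF P] Lf Qf obj lens_simps(4)[OF M])
    show "l (x, Comp P s r) = Comp X (l (Cod X (l (x, r)), s)) (l (x, r))"
      if "x \<in> Obj X" "r \<in> Arr P" "s \<in> Arr P" "Dom P r = on_obj L x" "Dom P s = Cod P r" for x r s
    proof -
      \<comment> \<open>Functoriality of \<open>Q\<close> reduces the composition law to that of
        \<open>M\<close>; the endpoint of the first lift lies over \<open>Cod P r\<close>, so
        \<open>s\<close> can be lifted there.\<close>
      have "l (x, Comp P s r) = lift M (x, Comp D (on_arr Q s) (on_arr Q r))"
        using that by (simp add: l category_simps[OF P] Qf)
      also have "\<dots> = Comp X (lift M (Cod X (l (x, r)), on_arr Q s)) (l (x, r))"
        using that u[of x r] lens_simps(5)[OF M, of x "on_arr Q r" "on_arr Q s"]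
        by (simp add: l Qf)
      also have "lift M (Cod X (l (x, r)), on_arr Q s) = l (Cod X (l (x, r)), s)"
        using that Cod_l[of x r] by (simp add: l)
      finally show ?thesis .
    qed
  qed (simp_all add: l_ext lM Ll)
  show "lens_comp X D Q L' = M"
  proof (rule lens_eqI[where A = X and B = D])
    fix x d assume "x \<in> Obj X" "d \<in> Arr D" "Dom D d = on_obj (lens_comp X D Q L') x"
    then have xd: "x \<in> Obj X" "d \<in> Arr D" "Dom D d = on_obj Q (on_obj L x)"
      by (simp_all add: lens_comp_simps)
    \<comment> \<open>The composite lifts \<open>d\<close> as \<open>M\<close> lifts
      \<open>on_arr Q (lift Q (on_obj L x, d))\<close>, and that arrow is \<open>d\<close>.\<close>
    then show "lift (lens_comp X D Q L') (x, d) = lift M (x, d)"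
      using lens_simps(1-3)[OF Q(1), of "on_obj L x" d] Lf(1)
      by (simp add: lens_comp_simps l)
  qed (simp_all add: lens_comp_extensional lens_comp_simps obj arr
        functor_extensional[OF lens_functor[OF M]] lens_lift_extensional[OF M])
qed

section \<open>Pairing of two lenses\<close>

text \<open>Stated for an abstract square, so that it applies to both orientations of the cospan.\<close>

lemma lens_pairing_ex1:
  fixes L :: "('x, 'y, 'r, 'k) fctr" and H :: "('x, 'y, 'o, 'm) lens"
  assumes X: "category X" and P: "category P" and A: "category A"
    and Q0: "is_lens P A Q0" and Q1: "is_lens P C Q1" "discrete_opfibration P C Q1"
    and F: "is_lens A B F" "discrete_opfibration A B F" and G: "is_lens C B G"
    and square: "lens_comp P B F Q0 = lens_comp P B G Q1"
    and obj_inj: "\<And>p p'. \<lbrakk>p \<in> Obj P; p' \<in> Obj P; on_obj Q0 p = on_obj Q0 p';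
      on_obj Q1 p = on_obj Q1 p'\<rbrakk> \<Longrightarrow> p = p'"
    and arr_inj: "\<And>r r'. \<lbrakk>r \<in> Arr P; r' \<in> Arr P; on_arr Q0 r = on_arr Q0 r';
      on_arr Q1 r = on_arr Q1 r'\<rbrakk> \<Longrightarrow> r = r'"
    and H: "is_lens X A H" and K: "is_lens X C K"
    and cone: "lens_comp X B F H = lens_comp X B G K"
    and L: "is_functor X P L"
    and obj: "\<And>x. x \<in> Obj X \<Longrightarrow> on_obj Q0 (on_obj L x) = on_obj H x"
      "\<And>x. x \<in> Obj X \<Longrightarrow> on_obj Q1 (on_obj L x) = on_obj K x"
    and arr: "\<And>y. y \<in> Arr X \<Longrightarrow> on_arr Q0 (on_arr L y) = on_arr H y"
      "\<And>y. y \<in> Arr X \<Longrightarrow> on_arr Q1 (on_arr L y) = on_arr K y"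
  shows "\<exists>!L'. is_lens X P L' \<and> lens_comp X A Q0 L' = H \<and> lens_comp X C Q1 L' = K"
proof -
  obtain L' where L': "is_lens X P L'" "on_obj L' = on_obj L" "on_arr L' = on_arr L"
    and K_eq: "lens_comp X C Q1 L' = K"
    using lens_over_discrete_opfibration[OF X P L Q1 K obj(2) arr(2)] by blast
  \<comment> \<open>The lifts of \<open>L'\<close> come from \<open>K\<close>, so only the
    underlying functors are known to compose with \<open>Q0\<close> to \<open>H\<close>; cancelling
    \<open>F\<close> settles the lifting operations.\<close>
  have H_eq: "lens_comp X A Q0 L' = H"
  proof (rule lens_cancel_discrete_opfibration[OF A lens_comp_is_lens[OF X P A L'(1) Q0] H F])
    show "lens_comp X B F (lens_comp X A Q0 L') = lens_comp X B F H"
      by (simp add: square K_eq cone lens_comp_assoc[OF L'(1) Q1(1) G]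
          flip: lens_comp_assoc[OF L'(1) Q0 F(1)])
    show "on_obj (lens_comp X A Q0 L') = on_obj H"
      by (rule extensionalityI[OF lens_comp_extensional(1)
            functor_extensional(1)[OF lens_functor[OF H]]])
        (simp add: lens_comp_simps L' obj)
    show "on_arr (lens_comp X A Q0 L') = on_arr H"
      by (rule extensionalityI[OF lens_comp_extensional(2)
            functor_extensional(2)[OF lens_functor[OF H]]])
        (simp add: lens_comp_simps L' arr)
  qed
  show ?thesis
  proof (intro ex1I conjI)
    show "is_lens X P L'" "lens_comp X A Q0 L' = H" "lens_comp X C Q1 L' = K"
      by (fact L'(1) H_eq K_eq)+
  next
    fix N assume "is_lens X P N \<and> lens_comp X A Q0 N = H \<and> lens_comp X C Q1 N = K"
    then have N: "is_lens X P N" and N0: "lens_comp X A Q0 N = H" and N1: "lens_comp X C Q1 N = K"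
      by simp_all
    note Nf = functor_simps[OF lens_functor[OF N]] and Lf = functor_simps[OF L]
    show "N = L'"
    \<comment> \<open>Cancelling \<open>Q1\<close> leaves the underlying functors, which agree
      because \<open>Q0\<close> and \<open>Q1\<close> are jointly injective.\<close>
    proof (rule lens_cancel_discrete_opfibration[OF P N L'(1) Q1])
      show "lens_comp X C Q1 N = lens_comp X C Q1 L'"
        by (simp add: N1 K_eq)
      show "on_obj N = on_obj L'"
      proof (rule extensionalityI)
        fix x assume x: "x \<in> Obj X"
        have "on_obj Q0 (on_obj N x) = on_obj H x" "on_obj Q1 (on_obj N x) = on_obj K x"
          using x by (simp_all add: lens_comp_simps flip: N0 N1)
        with x show "on_obj N x = on_obj L' x"
          by (intro obj_inj) (simp_all add: L' obj Nf Lf)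
      qed (rule functor_extensional[OF lens_functor] N L')+
      show "on_arr N = on_arr L'"
      proof (rule extensionalityI)
        fix y assume y: "y \<in> Arr X"
        have "on_arr Q0 (on_arr N y) = on_arr H y" "on_arr Q1 (on_arr N y) = on_arr K y"
          using y by (simp_all add: lens_comp_simps flip: N0 N1)
        with y show "on_arr N y = on_arr L' y"
          by (intro arr_inj) (simp_all add: L' arr Nf Lf)
      qed (rule functor_extensional[OF lens_functor] N L')+
    qed
  qed
qed

section \<open>The imported pullback and its projections\<close>

lemma pullback_cat_simps:
  "Obj (pullback_cat A C f g) =
    {(a, c). a \<in> Obj A \<and> c \<in> Obj C \<and> on_obj f a = on_obj g c}"
  "Arr (pullback_cat A C f g) =
    {(u, w). u \<in> Arr A \<and> w \<in> Arr C \<and> on_arr f u = on_arr g w}"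
  "Dom (pullback_cat A C f g) (u, w) = (Dom A u, Dom C w)"
  "Cod (pullback_cat A C f g) (u, w) = (Cod A u, Cod C w)"
  "Id (pullback_cat A C f g) (a, c) = (Id A a, Id C c)"
  "Comp (pullback_cat A C f g) (u', w') (u, w) = (Comp A u' u, Comp C w' w)"
  by (simp_all add: pullback_cat_def)

lemma imported_proj_functor_simps:
  "on_obj (imported_proj0 A C F G) = restrict fst (Obj (pullback_cat A C F G))"
  "on_arr (imported_proj0 A C F G) = restrict fst (Arr (pullback_cat A C F G))"
  "on_obj (imported_proj1 A C F G) = restrict snd (Obj (pullback_cat A C F G))"
  "on_arr (imported_proj1 A C F G) = restrict snd (Arr (pullback_cat A C F G))"
  by (simp_all add: imported_proj0_def imported_proj1_def Let_def)

lemma lift_imported_proj: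
  "\<lbrakk>(a, c) \<in> Obj (pullback_cat A C F G); u \<in> Arr A; Dom A u = a\<rbrakk>
    \<Longrightarrow> lift (imported_proj0 A C F G) ((a, c), u) = (u, lift G (c, on_arr F u))"
  "\<lbrakk>(a, c) \<in> Obj (pullback_cat A C F G); w \<in> Arr C; Dom C w = c\<rbrakk>
    \<Longrightarrow> lift (imported_proj1 A C F G) ((a, c), w) = (lift F (a, on_arr G w), w)"
  by (simp_all add: imported_proj0_def imported_proj1_def Let_def lift_dom_def)

lemma lift_imported_proj_extensional:
  fixes A :: "('o, 'm) cat" and C :: "('q, 'l) cat"
    and F :: "('o, 'm, 'p, 'n) lens" and G :: "('q, 'l, 'p, 'n) lens"
  defines "P \<equiv> pullback_cat A C F G"
  shows "lift (imported_proj0 A C F G)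
      \<in> extensional (lift_dom P A (on_obj (imported_proj0 A C F G)))"
    and "lift (imported_proj1 A C F G)
      \<in> extensional (lift_dom P C (on_obj (imported_proj1 A C F G)))"
proof -
  have "lift_dom P A (on_obj (imported_proj0 A C F G)) = lift_dom P A fst"
    "lift_dom P C (on_obj (imported_proj1 A C F G)) = lift_dom P C snd"
    by (rule lift_dom_cong; simp add: imported_proj_functor_simps P_def)+
  then show "lift (imported_proj0 A C F G)
      \<in> extensional (lift_dom P A (on_obj (imported_proj0 A C F G)))"
    and "lift (imported_proj1 A C F G)
      \<in> extensional (lift_dom P C (on_obj (imported_proj1 A C F G)))"
    by (simp_all add: imported_proj0_def imported_proj1_def Let_def P_def)
qed

lemma pullback_cat_category:
  assumes A: "category A" and C: "category C"
    and f: "is_functor A B f" and g: "is_functor C B g"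
  shows "category (pullback_cat A C f g)"
  unfolding category_def
  \<comment> \<open>A pair \<open>(u, w)\<close> has endpoints in the pullback because
    \<open>on_arr f u = on_arr g w\<close>; the flipped rules express images of endpoints through
    these arrows, so that this equation applies.\<close>
  by (auto simp: pullback_cat_simps category_simps[OF A] category_simps[OF C]
      category_unit_assoc[OF A] category_unit_assoc[OF C] functor_simps[OF f] functor_simps[OF g]
      simp flip: functor_simps(3,4)[OF f] functor_simps(3,4)[OF g])

lemma imported_proj_functors:
  assumes P: "category (pullback_cat A C F G)"
  shows "is_functor (pullback_cat A C F G) A (imported_proj0 A C F G)"
    and "is_functor (pullback_cat A C F G) C (imported_proj1 A C F G)"
  using category_simps[OF P]
  unfolding is_functor_def PiE_def imported_proj_functor_simps
  by (auto simp: pullback_cat_simps)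

text \<open>The pair \<open>(u, lift G (c, on_arr F u))\<close> is an arrow of the pullback since
  \<open>G\<close> sends its second component to \<open>on_arr F u\<close>. The lens laws hold
  componentwise, by those of \<open>G\<close> and functoriality of \<open>F\<close>; the other
  projection is symmetric.\<close>

lemma imported_proj_lenses:
  assumes A: "category A" and C: "category C" and F: "is_lens A B F" and G: "is_lens C B G"
  shows "is_lens (pullback_cat A C F G) A (imported_proj0 A C F G)"
    and "is_lens (pullback_cat A C F G) C (imported_proj1 A C F G)"
proof -
  note Ff = functor_simps[OF lens_functor[OF F]] and Gf = functor_simps[OF lens_functor[OF G]]
  note P = pullback_cat_category[OF A C lens_functor[OF F] lens_functor[OF G]]
  note simps = Ff Gf lens_simps[OF F] lens_simps[OF G]
    lens_Cod_lift[OF A F] lens_Cod_lift[OF C G] category_simps[OF A] category_simps[OF C]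
  show "is_lens (pullback_cat A C F G) A (imported_proj0 A C F G)"
    by (rule is_lensI[OF imported_proj_functors(1)[OF P] lift_imported_proj_extensional(1)])
      (auto simp: lift_imported_proj
        imported_proj_functor_simps pullback_cat_simps simps)
  show "is_lens (pullback_cat A C F G) C (imported_proj1 A C F G)"
    \<comment> \<open>In the identity law, the identity at \<open>on_obj G c\<close> has to be read
      as the identity at \<open>on_obj F a\<close> before the law for \<open>F\<close> applies; this
      is left to \<open>metis\<close>.\<close>
    by (rule is_lensI[OF imported_proj_functors(2)[OF P] lift_imported_proj_extensional(2)])
      (auto simp: lift_imported_proj
        imported_proj_functor_simps pullback_cat_simps simps, metis lens_simps(4)[OF F])
qed

text \<open>Both composites lift an arrow \<open>v\<close> of \<open>B\<close> at
  \<open>(a, c)\<close> to \<open>(lift F (a, v), lift G (c, v))\<close>, because each lens maps its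
  own lift back to \<open>v\<close>.\<close>

lemma imported_pullback_commutes:
  assumes A: "category A" and C: "category C" and F: "is_lens A B F" and G: "is_lens C B G"
  defines "P \<equiv> pullback_cat A C F G"
  shows "lens_comp P B F (imported_proj0 A C F G) = lens_comp P B G (imported_proj1 A C F G)"
  unfolding P_def
  by (rule lens_eqI[OF lens_comp_extensional(1,1,2,2,3,3)])
    (auto simp: lens_comp_simps lift_imported_proj
      imported_proj_functor_simps pullback_cat_simps lens_simps[OF F] lens_simps[OF G])

text \<open>The projection lens provides a lift. Any lift of \<open>w\<close> at
  \<open>(a, c)\<close> has the form \<open>(u, w)\<close> with
  \<open>on_arr F u = on_arr G w\<close> and \<open>u\<close> starting at \<open>a\<close>, which
  forces \<open>u\<close> to be the lift along \<open>F\<close>; the other case is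
  symmetric.\<close>

lemma imported_proj_discrete_opfibration:
  assumes A: "category A" and C: "category C" and F: "is_lens A B F" and G: "is_lens C B G"
  shows "discrete_opfibration A B F
      \<Longrightarrow> discrete_opfibration (pullback_cat A C F G) C (imported_proj1 A C F G)"
    and "discrete_opfibration C B G
      \<Longrightarrow> discrete_opfibration (pullback_cat A C F G) A (imported_proj0 A C F G)"
proof -
  let ?P = "pullback_cat A C F G"
  note P0 = imported_proj_lenses(1)[OF A C F G] and P1 = imported_proj_lenses(2)[OF A C F G]
  show "discrete_opfibration ?P C (imported_proj1 A C F G)" if dopf: "discrete_opfibration A B F"
    unfolding discrete_opfibration_def
  proof (intro conjI ballI impI)
    fix p w assume pw: "p \<in> Obj ?P" "w \<in> Arr C" "Dom C w = on_obj (imported_proj1 A C F G) p"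
    show "\<exists>!r. r \<in> Arr ?P \<and> Dom ?P r = p \<and> on_arr (imported_proj1 A C F G) r = w"
    proof (rule ex1I[of _ "lift (imported_proj1 A C F G) (p, w)"])
      fix r assume "r \<in> Arr ?P \<and> Dom ?P r = p \<and> on_arr (imported_proj1 A C F G) r = w"
      then show "r = lift (imported_proj1 A C F G) (p, w)"
        using pw lift_discrete_opfibration[OF A F dopf, of "fst r"]
        by (auto simp: lift_imported_proj imported_proj_functor_simps pullback_cat_simps)
    qed (simp add: pw lens_simps[OF P1])
  qed (rule lens_functor[OF P1])
  show "discrete_opfibration ?P A (imported_proj0 A C F G)" if dopf: "discrete_opfibration C B G"
    unfolding discrete_opfibration_def
  proof (intro conjI ballI impI)
    fix p u assume pu: "p \<in> Obj ?P" "u \<in> Arr A" "Dom A u = on_obj (imported_proj0 A C F G) p"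
    show "\<exists>!r. r \<in> Arr ?P \<and> Dom ?P r = p \<and> on_arr (imported_proj0 A C F G) r = u"
    proof (rule ex1I[of _ "lift (imported_proj0 A C F G) (p, u)"])
      fix r assume "r \<in> Arr ?P \<and> Dom ?P r = p \<and> on_arr (imported_proj0 A C F G) r = u"
      then show "r = lift (imported_proj0 A C F G) (p, u)"
        using pu lift_discrete_opfibration[OF C G dopf, of "snd r"]
        by (auto simp: lift_imported_proj imported_proj_functor_simps pullback_cat_simps)
    qed (simp add: pu lens_simps[OF P0])
  qed (rule lens_functor[OF P0])
qed

section \<open>The universal property of the imported pullback\<close>

lemma pairing_is_functor:
  fixes H :: "('x, 'y, 'o, 'm) lens" and K :: "('x, 'y, 'q, 'l) lens"
  assumes X: "category X" and h: "is_functor X A H" and k: "is_functor X C K"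
    and obj: "\<And>x. x \<in> Obj X \<Longrightarrow> on_obj F (on_obj H x) = on_obj G (on_obj K x)"
    and arr: "\<And>y. y \<in> Arr X \<Longrightarrow> on_arr F (on_arr H y) = on_arr G (on_arr K y)"
  shows "is_functor X (pullback_cat A C F G)
    \<lparr>on_obj = (\<lambda>x\<in>Obj X. (on_obj H x, on_obj K x)), on_arr = (\<lambda>y\<in>Arr X. (on_arr H y, on_arr K y))\<rparr>"
  using obj arr unfolding is_functor_def PiE_def
  by (auto simp: pullback_cat_simps category_simps[OF X] functor_simps[OF h] functor_simps[OF k])

theorem proposition5p10:
  fixes A :: "('o, 'm) cat" and B :: "('p, 'n) cat" and C :: "('q, 'l) cat"
    and F :: "('o, 'm, 'p, 'n) lens" and G :: "('q, 'l, 'p, 'n) lens"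
  assumes "category A" and "category B" and "category C"
    and "is_lens A B F" and "is_lens C B G"
    and "discrete_opfibration A B F \<or> discrete_opfibration C B G"
  shows "lens_pullback_square TYPE(('x, 'y) cat) (pullback_cat A C F G) A C B
           (imported_proj0 A C F G) (imported_proj1 A C F G) F G"
proof -
  note A = assms(1) and C = assms(3) and F = assms(4) and G = assms(5)
  let ?P = "pullback_cat A C F G"
  let ?p0 = "imported_proj0 A C F G" and ?p1 = "imported_proj1 A C F G"
  note P = pullback_cat_category[OF A C lens_functor[OF F] lens_functor[OF G]]
    and p0 = imported_proj_lenses(1)[OF A C F G] and p1 = imported_proj_lenses(2)[OF A C F G]
    and square = imported_pullback_commutes[OF A C F G]
  have ex1: "\<exists>!L. is_lens X ?P L \<and> lens_comp X A ?p0 L = H \<and> lens_comp X C ?p1 L = K"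
    if X: "category X" and H: "is_lens X A H" and K: "is_lens X C K"
      and cone: "lens_comp X B F H = lens_comp X B G K"
    for X :: "('x, 'y) cat" and H K
  proof -
    have obj: "on_obj F (on_obj H x) = on_obj G (on_obj K x)" if "x \<in> Obj X" for x
      using cone that by (metis lens_comp_simps(1))
    have arr: "on_arr F (on_arr H y) = on_arr G (on_arr K y)" if "y \<in> Arr X" for y
      using cone that by (metis lens_comp_simps(2))
    note Hf = functor_simps[OF lens_functor[OF H]] and Kf = functor_simps[OF lens_functor[OF K]]
    note L = pairing_is_functor[OF X lens_functor[OF H] lens_functor[OF K] obj arr]
    note simps = imported_proj_functor_simps pullback_cat_simps obj arr Hf Kf
    from assms(6) show ?thesis
    proof
      assume dopf: "discrete_opfibration A B F"
      show ?thesis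
        \<comment> \<open>The two open premises state joint injectivity of the projections, which
          holds because objects and arrows of the pullback are pairs.\<close>
        by (rule lens_pairing_ex1[OF X P A p0 p1
              imported_proj_discrete_opfibration(1)[OF A C F G dopf] F dopf G square _ _ H K cone L])
          (auto simp: simps)
    next
      assume dopf: "discrete_opfibration C B G"
      \<comment> \<open>The two legs exchange roles: the discrete opfibration is now
        \<open>?p0\<close>, so the lifts come from \<open>H\<close>. The square and the cone are
        reversed, and the same pairing functor serves.\<close>
      have "\<exists>!L. is_lens X ?P L \<and> lens_comp X C ?p1 L = K \<and> lens_comp X A ?p0 L = H"
        by (rule lens_pairing_ex1[OF X P C p1 p0
              imported_proj_discrete_opfibration(2)[OF A C F G dopf] G dopf F square[symmetric]
              _ _ K H cone[symmetric] L])
          (auto simp: simps)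
      then show ?thesis
        by (simp add: conj_commute)
    qed
  qed
  show ?thesis
    unfolding lens_pullback_square_def using assms P p0 p1 square ex1 by blast
qed

end
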